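(* Let $N_c\ge 1$ and $N_f\ge 1$ be integers, let $0\le t,\tilde t<1$, and let $x,y$ be $SU(N_f)$ fugacities. Then the Hilbert series of $U(N_c)$ SQCD with $N_f$ flavours equals the $N_c\times N_c$ Toeplitz determinant of the symbol $\phi$: $$g_{N_f,U(N_c)}(t,\tilde t,x,y)=\det\left(\frac{1}{2\pi i}\oint_{|z|=1}\frac{dz}{z}\,z^{a-b}\,\phi(t,\tilde t,x,y,z)\right)_{1\le a,b\le N_c}=D_{N_c}(\phi).$$
   Context: Fugacities: $x=(x_1,\dots,x_{N_f-1})$ and $y=(y_1,\dots,y_{N_f-1})$ are complex numbers of modulus $1$. Put $\xi_1=x_1$, $\xi_k=x_k/x_{k-1}$ for $2\le k\le N_f-1$, $\xi_{N_f}=1/x_{N_f-1}$, and define $\eta_1,\dots,\eta_{N_f}$ from $y$ in the same way (for $N_f=1$: $\xi_1=\eta_1=1$). Thus $\sum_i\xi_i$ is the character of the fundamental representation of the first $SU(N_f)$ and $\sum_j\eta_j^{-1}$ is the character of the antifundamental representation of the second $SU(N_f)$. Symbol: $\phi(t,\tilde t,x,y,z)=\prod_{i=1}^{N_f}\frac{1}{1-t\,\xi_i z^{-1}}\prod_{j=1}^{N_f}\frac{1}{1-\tilde t\,\eta_j^{-1}z}$. Hilbert series: with the $U(N_c)$ Haar measure, $$g_{N_f,U(N_c)}(t,\tilde t,x,y)=\frac{1}{N_c!(2\pi i)^{N_c}}\oint_{|z_1|=1}\frac{dz_1}{z_1}\cdots\oint_{|z_{N_c}|=1}\frac{dz_{N_c}}{z_{N_c}}\prod_{1\le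 a<b\le N_c}|z_a-z_b|^2\prod_{a=1}^{N_c}\phi(t,\tilde t,x,y,z_a).$$ Toeplitz determinant: for a continuous function $f$ on the unit circle with Fourier coefficients $f_k=\frac{1}{2\pi i}\oint_{|z|=1}\frac{dz}{z}z^{-k}f(z)$, $D_n(f)=\det(f_{j-k})_{j,k=1}^n$. *)

theory Defs
  imports
    "HOL-Complex_Analysis.Complex_Analysis"
    "Jordan_Normal_Form.Determinant"
begin

text \<open>A point \<open>(x\<^sub>1, \<dots>, x\<^bsub>Nf-1\<^esub>)\<close> is a function on \<^typ>\<open>nat\<close> of which only the values at
  \<open>1, \<dots>, Nf - 1\<close> are used; likewise for \<open>\<xi>\<^sub>1, \<dots>, \<xi>\<^bsub>Nf\<^esub>\<close> and the integration variables
  \<open>z\<^sub>1, \<dots>, z\<^bsub>Nc\<^esub>\<close>.\<close>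

definition SU_fugacities :: "nat \<Rightarrow> (nat \<Rightarrow> complex) \<Rightarrow> bool" where
  "SU_fugacities Nf x \<longleftrightarrow> (\<forall>k\<in>{1..Nf - 1}. cmod (x k) = 1)"

definition fund_weight :: "nat \<Rightarrow> (nat \<Rightarrow> complex) \<Rightarrow> nat \<Rightarrow> complex" where
  "fund_weight Nf x k =
     (if Nf = 1 then 1
      else if k = 1 then x 1
      else if k = Nf then 1 / x (Nf - 1)
      else x k / x (k - 1))"

definition symbol_phi ::
    "nat \<Rightarrow> real \<Rightarrow> real \<Rightarrow> (nat \<Rightarrow> complex) \<Rightarrow> (nat \<Rightarrow> complex) \<Rightarrow> complex \<Rightarrow> complex" where
  "symbol_phi Nf t t' x y z =
     (\<Prod>i=1..Nf. 1 / (1 - of_real t * fund_weight Nf x i * inverse z)) *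
     (\<Prod>j=1..Nf. 1 / (1 - of_real t' * inverse (fund_weight Nf y j) * z))"

text \<open>The iterated integral \<open>\<oint> dz\<^sub>1/z\<^sub>1 \<dots> \<oint> dz\<^sub>n/z\<^sub>n F(z\<^sub>1, \<dots>, z\<^sub>n)\<close> over unit circles, with \<open>z\<^sub>n\<close>
  innermost. The constant function in the base case only supplies the irrelevant values of \<open>z\<close>
  outside \<open>1, \<dots>, n\<close>.\<close>

primrec iterated_circle_integral :: "nat \<Rightarrow> ((nat \<Rightarrow> complex) \<Rightarrow> complex) \<Rightarrow> complex" where
  "iterated_circle_integral 0 F = F (\<lambda>_. 0)"
| "iterated_circle_integral (Suc n) F =
     iterated_circle_integral n
       (\<lambda>z. contour_integral (circlepath 0 1) (\<lambda>w. 1 / w * F (z(Suc n := w))))"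

definition hilbert_series ::
    "nat \<Rightarrow> nat \<Rightarrow> real \<Rightarrow> real \<Rightarrow> (nat \<Rightarrow> complex) \<Rightarrow> (nat \<Rightarrow> complex) \<Rightarrow> complex" where
  "hilbert_series Nf Nc t t' x y =
     1 / (fact Nc * (2 * of_real pi * \<i>) ^ Nc) *
     iterated_circle_integral Nc (\<lambda>z.
       (\<Prod>(a, b)\<in>{(a, b). 1 \<le> a \<and> a < b \<and> b \<le> Nc}. of_real ((cmod (z a - z b))\<^sup>2)) *
       (\<Prod>a=1..Nc. symbol_phi Nf t t' x y (z a)))"

definition fourier_coeff :: "(complex \<Rightarrow> complex) \<Rightarrow> int \<Rightarrow> complex" where
  "fourier_coeff f k =
     1 / (2 * of_real pi * \<i>) *
     contour_integral (circlepath 0 1) (\<lambda>z. 1 / z * z powi (- k) * f z)"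

text \<open>Matrix indices run from \<open>0\<close> to \<open>n - 1\<close>; the entries depend only on differences of indices,
  so this is the matrix indexed by \<open>1, \<dots>, n\<close>.\<close>

definition toeplitz_det :: "nat \<Rightarrow> (complex \<Rightarrow> complex) \<Rightarrow> complex" where
  "toeplitz_det n f =
     Determinant.det (Matrix.mat n n (\<lambda>(j, k). fourier_coeff f (int j - int k)))"

end

theory Submission
  imports Defs
begin

text \<open>On the unit circle \<open>cnj z = inverse z\<close>, so \<open>\<Prod>\<^bsub>a<b\<^esub> |z\<^sub>a - z\<^sub>b|\<^sup>2\<close> is the product of the Vandermonde
  determinants of \<open>z\<close> and of \<open>inverse z\<close>. Expanding both over permutations \<open>p\<close> and \<open>q\<close>, each
  summand factorises over the variables and integrates to a product of moments indexed by
  \<open>(p a, q a)\<close>; for each fixed \<open>p\<close> the sum over \<open>q\<close> is the moment determinant, and the \<open>n!\<close>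
  choices of \<open>p\<close> cancel the factor \<open>1 / n!\<close>.\<close>

section \<open>Determinant identities\<close>

lemma permutes_atLeast0LessThan_less:
  fixes i n :: nat
  assumes "p permutes {0..<n}" "i < n"
  shows "p i < n"
  using permutes_in_image[OF assms(1), of i] assms(2) by simp

text \<open>Each term of the Leibniz expansion takes exactly one entry from every row, so it
  contains every \<open>c i\<close> once.\<close>

lemma det_mult_rows:
  fixes c :: "nat \<Rightarrow> 'a :: comm_ring_1"
  shows "Determinant.det (Matrix.mat n n (\<lambda>(i, j). c i * A i j)) =
           (\<Prod>i<n. c i) * Determinant.det (Matrix.mat n n (\<lambda>(i, j). A i j))"
proof -
  have "(\<Prod>i = 0..<n. Matrix.mat n n (\<lambda>(i, j). c i * A i j) $$ (i, p i)) =
          (\<Prod>i<n. c i) * (\<Prod>i = 0..<n. Matrix.mat n n (\<lambda>(i, j). A i j) $$ (i, p i))"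
    if "p permutes {0..<n}" for p
    using that
    by (auto simp: prod.distrib[symmetric] lessThan_atLeast0 permutes_atLeast0LessThan_less intro!: prod.cong)
  then show ?thesis
    by (simp add: det_def sum_distrib_left mult.left_commute)
qed

text \<open>Induction on \<open>n\<close>: unimodular column operations built from the last node
  \<open>x n\<close> reduce the last row to a single entry, and the remaining minor is the smaller
  Vandermonde matrix with row \<open>i\<close> scaled by \<open>x i - x n\<close>.\<close>

lemma det_vandermonde:
  fixes x :: "nat \<Rightarrow> 'a :: comm_ring_1"
  shows "Determinant.det (Matrix.mat n n (\<lambda>(i, j). x i ^ j)) = (\<Prod>j<n. \<Prod>i<j. x j - x i)"
proof (induction n)
  case 0
  then show ?case by (simp add: det_def)
next
  case (Suc n)
  \<comment> \<open>Multiplying by \<open>U\<close> subtracts \<open>x n\<close> times column \<open>j - 1\<close> from each column \<open>j\<close>.\<close>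
  define V where "V = Matrix.mat (Suc n) (Suc n) (\<lambda>(i, j). x i ^ j)"
  define U where "U = Matrix.mat (Suc n) (Suc n)
    (\<lambda>(k, j). if k = j then 1 else if Suc k = j then - x n else 0)"
  define W where "W = Matrix.mat (Suc n) (Suc n)
    (\<lambda>(i, j). if j = 0 then 1 else (x i - x n) * x i ^ (j - 1))"
  have carrier: "V \<in> carrier_mat (Suc n) (Suc n)" "U \<in> carrier_mat (Suc n) (Suc n)"
      "W \<in> carrier_mat (Suc n) (Suc n)"
    by (simp_all add: V_def U_def W_def)
  have "V * U = W"
  proof (rule eq_matI)
    fix i j assume "i < dim_row W" "j < dim_col W"
    then have ij: "i < Suc n" "j < Suc n" by (simp_all add: W_def)
    have "(V * U) $$ (i, j) =
        (\<Sum>k<Suc n. x i ^ k * (if k = j then 1 else if Suc k = j then - x n else 0))"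
      using ij by (simp add: V_def U_def scalar_prod_def lessThan_atLeast0 del: sum.op_ivl_Suc)
    also have "\<dots> = (\<Sum>k<Suc n. (if k = j then x i ^ k else 0) +
        (if Suc k = j then - x n * x i ^ k else 0))"
      by (intro sum.cong) auto
    also have "\<dots> = x i ^ j + (\<Sum>k<Suc n. if Suc k = j then - x n * x i ^ k else 0)"
      using ij by (simp add: sum.distrib del: sum.lessThan_Suc)
    also have "\<dots> = W $$ (i, j)"
      using ij by (cases j) (auto simp: W_def algebra_simps simp del: sum.lessThan_Suc)
    finally show "(V * U) $$ (i, j) = W $$ (i, j)" .
  qed (simp_all add: V_def U_def W_def)
  moreover have "Determinant.det U = 1"
  proof -
    have "upper_triangular U"
      by (auto simp: U_def)
    then have "Determinant.det U = prod_list (diag_mat U)"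
      by (rule det_upper_triangular[OF _ carrier(2)])
    also have "diag_mat U = map (\<lambda>i. 1) [0..<Suc n]"
      unfolding diag_mat_def by (rule map_cong) (auto simp: U_def)
    also have "prod_list \<dots> = 1"
      by (simp add: map_replicate_const)
    finally show ?thesis .
  qed
  ultimately have "Determinant.det V = Determinant.det W"
    using det_mult[OF carrier(1,2)] by simp
  also have "\<dots> = (\<Sum>j<Suc n. W $$ (n, j) * cofactor W n j)"
    by (rule laplace_expansion_row[OF carrier(3)]) simp
  \<comment> \<open>Row \<open>n\<close> of \<open>W\<close> is \<open>1, 0, ..., 0\<close>: every
    entry right of the first column has the factor \<open>x n - x n\<close>.\<close>
  also have "\<dots> = (\<Sum>j<Suc n. if j = 0 then cofactor W n j else 0)"
    by (intro sum.cong) (auto simp: W_def)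
  also have "\<dots> = cofactor W n 0"
    by (simp del: sum.lessThan_Suc)
  also have "mat_delete W n 0 = Matrix.mat n n (\<lambda>(i, j). (x i - x n) * x i ^ j)"
    by (rule eq_matI) (auto simp: mat_delete_def W_def)
  then have "cofactor W n 0 =
      (-1) ^ n * ((\<Prod>i<n. x i - x n) * (\<Prod>j<n. \<Prod>i<j. x j - x i))"
    by (simp add: cofactor_def det_mult_rows Suc.IH)
  \<comment> \<open>The cofactor sign \<open>(-1) ^ n\<close> is spread over the \<open>n\<close>
    factors, turning each into \<open>x n - x i\<close>, the order required for
    \<open>j = n\<close>.\<close>
  also have "\<dots> = (\<Prod>i<n. - (x i - x n)) * (\<Prod>j<n. \<Prod>i<j. x j - x i)"
    by (simp only: prod_uminus card_lessThan mult.assoc)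
  also have "\<dots> = (\<Prod>j<Suc n. \<Prod>i<j. x j - x i)"
    by (simp add: mult.commute)
  finally show ?case by (simp add: V_def)
qed

text \<open>For fixed \<open>p\<close>, the sum over \<open>q\<close> expands the determinant of the
  matrix with rows permuted by \<open>p\<close>. This gives a second \<open>signof p\<close>, which
  cancels the first, so all \<open>n!\<close> inner sums agree.\<close>

lemma det_sum_permuted_rows_and_columns:
  fixes m :: "nat \<Rightarrow> nat \<Rightarrow> 'a :: comm_ring_1"
  shows "(\<Sum>(p, q)\<in>{p. p permutes {0..<n}} \<times> {q. q permutes {0..<n}}.
            signof p * signof q * (\<Prod>i<n. m (p i) (q i))) =
         of_nat (fact n) * Determinant.det (Matrix.mat n n (\<lambda>(i, j). m i j))"
proof -
  define M where "M = Matrix.mat n n (\<lambda>(i, j). m i j)"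
  have M: "M \<in> carrier_mat n n" by (simp add: M_def)
  have row: "(\<Sum>q | q permutes {0..<n}. signof p * signof q * (\<Prod>i<n. m (p i) (q i))) =
      Determinant.det M" if p: "p permutes {0..<n}" for p
  proof -
    have "(\<Sum>q | q permutes {0..<n}. signof p * signof q * (\<Prod>i<n. m (p i) (q i))) =
        signof p * Determinant.det (Matrix.mat n n (\<lambda>(i, j). M $$ (p i, j)))"
      using p
      by (auto simp: det_def M_def sum_distrib_left mult.assoc permutes_atLeast0LessThan_less lessThan_atLeast0
          intro!: sum.cong prod.cong arg_cong2[of _ _ _ _ "(*)"])
    also have "\<dots> = signof p * signof p * Determinant.det M"
      by (simp add: det_permute_rows[OF M p] mult.assoc)
    also have "signof p * signof p = (1 :: 'a)"
      by (simp add: sign_def)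
    finally show ?thesis by simp
  qed
  have "(\<Sum>(p, q)\<in>{p. p permutes {0..<n}} \<times> {q. q permutes {0..<n}}.
            signof p * signof q * (\<Prod>i<n. m (p i) (q i))) =
        (\<Sum>p | p permutes {0..<n}. Determinant.det M)"
    by (simp add: sum.cartesian_product[symmetric] row)
  also have "\<dots> = of_nat (fact n) * Determinant.det M"
    by (simp add: card_permutations)
  finally show ?thesis by (simp add: M_def)
qed

section \<open>Iterated integrals over the torus\<close>

text \<open>Allows the integrand to be rewritten by identities that hold only on the torus, such as
  \<open>cnj z = inverse z\<close>.\<close>

lemma iterated_circle_integral_cong:
  assumes "\<And>z. (\<And>i. i \<in> {1..n} \<Longrightarrow> cmod (z i) = 1) \<Longrightarrow> F z = G z"
  shows "iterated_circle_integral n F = iterated_circle_integral n G"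
  using assms
proof (induction n arbitrary: F G)
  case 0
  then show ?case by simp
next
  case (Suc n)
  have "contour_integral (circlepath 0 1) (\<lambda>w. 1 / w * F (z(Suc n := w))) =
        contour_integral (circlepath 0 1) (\<lambda>w. 1 / w * G (z(Suc n := w)))"
    if "\<And>i. i \<in> {1..n} \<Longrightarrow> cmod (z i) = 1" for z
  proof (rule contour_integral_eq)
    fix w assume "w \<in> path_image (circlepath 0 1)"
    then have "F (z(Suc n := w)) = G (z(Suc n := w))"
      using that by (intro Suc.prems) auto
    then show "1 / w * F (z(Suc n := w)) = 1 / w * G (z(Suc n := w))" by simp
  qed
  then show ?case
    unfolding iterated_circle_integral.simps by (rule Suc.IH)
qed

text \<open>In each summand the innermost variable occurs in one factor only. Linearity therefore
  suffices, and the order of integration is never changed.\<close>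

lemma iterated_circle_integral_sum_prod:
  assumes "finite S"
    and cont: "\<And>s a. s \<in> S \<Longrightarrow> a \<in> {1..n} \<Longrightarrow> continuous_on (sphere 0 1) (g s a)"
  shows "iterated_circle_integral n (\<lambda>z. \<Sum>s\<in>S. c s * (\<Prod>a=1..n. g s a (z a))) =
    (\<Sum>s\<in>S. c s * (\<Prod>a=1..n. contour_integral (circlepath 0 1) (\<lambda>w. 1 / w * g s a w)))"
  using cont
proof (induction n arbitrary: c)
  case 0
  then show ?case by simp
next
  case (Suc n)
  \<comment> \<open>\<open>I s\<close> does not depend on the outer variables, so it joins the
    coefficient \<open>c s\<close>; this is why the induction keeps \<open>c\<close>
    arbitrary.\<close>
  define I where "I s = contour_integral (circlepath 0 1) (\<lambda>w. 1 / w * g s (Suc n) w)" for s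
  have integrable: "(\<lambda>w. 1 / w * g s (Suc n) w) contour_integrable_on circlepath 0 1"
    if "s \<in> S" for s
    using that
    by (intro contour_integrable_continuous_circlepath continuous_intros)
       (auto intro: Suc.prems)
  have "contour_integral (circlepath 0 1)
      (\<lambda>w. 1 / w * (\<Sum>s\<in>S. c s * (\<Prod>a=1..Suc n. g s a ((z(Suc n := w)) a)))) =
      (\<Sum>s\<in>S. (c s * I s) * (\<Prod>a=1..n. g s a (z a)))" for z
  proof -
    have "(\<Prod>a=1..n. g s a ((z(Suc n := w)) a)) = (\<Prod>a=1..n. g s a (z a))" for s w
      by (rule prod.cong) auto
    then have "contour_integral (circlepath 0 1)
        (\<lambda>w. 1 / w * (\<Sum>s\<in>S. c s * (\<Prod>a=1..Suc n. g s a ((z(Suc n := w)) a)))) =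
        contour_integral (circlepath 0 1)
          (\<lambda>w. \<Sum>s\<in>S. (c s * (\<Prod>a=1..n. g s a (z a))) * (1 / w * g s (Suc n) w))"
      by (simp add: sum_distrib_left mult_ac)
    also have "\<dots> = (\<Sum>s\<in>S. (c s * (\<Prod>a=1..n. g s a (z a))) * I s)"
      unfolding I_def using \<open>finite S\<close> integrable
      by (simp only: contour_integral_sum contour_integral_lmul contour_integrable_lmul
          cong: sum.cong)
    finally show ?thesis by (simp add: mult_ac)
  qed
  then show ?case
    using Suc.IH[of "\<lambda>s. c s * I s"] Suc.prems by (simp add: I_def mult_ac)
qed

section \<open>Heine's identity\<close>

lemma prod_cmod_diff_eq_det_vandermonde:
  fixes z :: "nat \<Rightarrow> complex"
  assumes "\<And>i. i \<in> {1..n} \<Longrightarrow> cmod (z i) = 1"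
  shows "(\<Prod>(a, b)\<in>{(a, b). 1 \<le> a \<and> a < b \<and> b \<le> n}. of_real ((cmod (z a - z b))\<^sup>2)) =
    Determinant.det (Matrix.mat n n (\<lambda>(i, j). z (Suc i) ^ j)) *
    Determinant.det (Matrix.mat n n (\<lambda>(i, j). inverse (z (Suc i)) ^ j))"
proof -
  have cnj: "inverse (z i) = cnj (z i)" if "i \<in> {1..n}" for i
    using assms[OF that] by (simp add: inverse_complex_def complex_eq_iff cmod_def)
  have "(\<Prod>(a, b)\<in>{(a, b). 1 \<le> a \<and> a < b \<and> b \<le> n}. complex_of_real ((cmod (z a - z b))\<^sup>2)) =
      (\<Prod>(j, i)\<in>(SIGMA j:{..<n}. {..<j}). of_real ((cmod (z (Suc j) - z (Suc i)))\<^sup>2))"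
    \<comment> \<open>The pairs become zero-based with the larger index first, as in
      \<open>det_vandermonde\<close>; the swap leaves the modulus unchanged.\<close>
    by (rule prod.reindex_bij_witness[of _ "\<lambda>(j, i). (Suc i, Suc j)" "\<lambda>(a, b). (b - 1, a - 1)"])
       (auto simp: norm_minus_commute)
  also have "\<dots> = (\<Prod>j<n. \<Prod>i<j. of_real ((cmod (z (Suc j) - z (Suc i)))\<^sup>2))"
    by (simp add: prod.Sigma)
  also have "\<dots> = (\<Prod>j<n. \<Prod>i<j. (z (Suc j) - z (Suc i)) *
      (inverse (z (Suc j)) - inverse (z (Suc i))))"
    by (intro prod.cong refl) (simp add: cnj complex_norm_square del: of_real_power)
  also have "\<dots> = Determinant.det (Matrix.mat n n (\<lambda>(i, j). z (Suc i) ^ j)) *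
      Determinant.det (Matrix.mat n n (\<lambda>(i, j). inverse (z (Suc i)) ^ j))"
    by (simp add: det_vandermonde prod.distrib)
  finally show ?thesis .
qed

text \<open>The moments are left unnormalised here; the powers of \<open>1 / (2 pi i)\<close> are
  distributed over the rows only at the end.\<close>

lemma Heine_identity:
  assumes cont: "continuous_on (sphere 0 1) f"
  shows "iterated_circle_integral n (\<lambda>z.
      (\<Prod>(a, b)\<in>{(a, b). 1 \<le> a \<and> a < b \<and> b \<le> n}. of_real ((cmod (z a - z b))\<^sup>2)) *
      (\<Prod>a=1..n. f (z a))) =
    fact n * Determinant.det (Matrix.mat n n (\<lambda>(a, b).
      contour_integral (circlepath 0 1) (\<lambda>z. 1 / z * z powi (int a - int b) * f z)))"
    (is "iterated_circle_integral n ?F = _")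
proof -
  let ?P = "{p. p permutes {0..<n}}"
  \<comment> \<open>Variables are numbered from 1 while the permutations act on
    \<open>{0..<n}\<close>, hence \<open>a - 1\<close>. The exponent may be negative;
    \<open>powi\<close> stays continuous because the circle avoids 0.\<close>
  define g where "g = (\<lambda>(p :: nat \<Rightarrow> nat, q :: nat \<Rightarrow> nat) a w.
    w powi (int (p (a - 1)) - int (q (a - 1))) * f w)"
  define c :: "(nat \<Rightarrow> nat) \<times> (nat \<Rightarrow> nat) \<Rightarrow> complex"
    where "c = (\<lambda>(p, q). signof p * signof q)"
  have F_eq: "?F z = (\<Sum>s\<in>?P \<times> ?P. c s * (\<Prod>a=1..n. g s a (z a)))"
    if z: "\<And>i. i \<in> {1..n} \<Longrightarrow> cmod (z i) = 1" for z
  proof -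
    \<comment> \<open>Stated for arbitrary \<open>u\<close> because it is applied both to
      \<open>z\<close> and to its pointwise inverse.\<close>
    have vandermonde: "Determinant.det (Matrix.mat n n (\<lambda>(i, j). u (Suc i) ^ j)) =
        (\<Sum>p\<in>?P. signof p * (\<Prod>a=1..n. u a ^ p (a - 1)))" for u :: "nat \<Rightarrow> complex"
    proof -
      have "(\<Prod>i = 0..<n. Matrix.mat n n (\<lambda>(i, j). u (Suc i) ^ j) $$ (i, p i)) =
          (\<Prod>a=1..n. u a ^ p (a - 1))" if "p permutes {0..<n}" for p
        using that
        by (intro prod.reindex_bij_witness[of _ "\<lambda>a. a - 1" Suc]) (auto simp: permutes_atLeast0LessThan_less)
      then show ?thesis by (simp add: det_def)
    qed
    have factor: "z a ^ p (a - 1) * inverse (z a) ^ q (a - 1) * f (z a) = g (p, q) a (z a)"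
      if "a \<in> {1..n}" for a p q
    proof -
      have "z a \<noteq> 0" using z[OF that] by auto
      then show ?thesis
        by (simp add: g_def power_int_diff power_inverse divide_inverse)
    qed
    have "?F z = (\<Sum>p\<in>?P. signof p * (\<Prod>a=1..n. z a ^ p (a - 1))) *
        (\<Sum>q\<in>?P. signof q * (\<Prod>a=1..n. inverse (z a) ^ q (a - 1))) * (\<Prod>a=1..n. f (z a))"
      using prod_cmod_diff_eq_det_vandermonde[of n z, OF z]
        vandermonde[of z] vandermonde[of "\<lambda>a. inverse (z a)"] by simp
    also have "\<dots> = (\<Sum>(p, q)\<in>?P \<times> ?P. signof p * signof q *
        (\<Prod>a=1..n. z a ^ p (a - 1) * inverse (z a) ^ q (a - 1) * f (z a)))"
      unfolding sum_product sum.cartesian_product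
      unfolding sum_distrib_right
      by (intro sum.cong refl) (simp add: prod.distrib case_prod_unfold mult_ac)
    also have "\<dots> = (\<Sum>s\<in>?P \<times> ?P. c s * (\<Prod>a=1..n. g s a (z a)))"
      using factor by (intro sum.cong refl) (auto simp: c_def intro!: prod.cong)
    finally show ?thesis .
  qed
  have g_cont: "continuous_on (sphere 0 1) (g s a)" for s a
    unfolding g_def by (cases s) (auto intro!: continuous_intros cont)
  have "iterated_circle_integral n ?F =
      iterated_circle_integral n (\<lambda>z. \<Sum>s\<in>?P \<times> ?P. c s * (\<Prod>a=1..n. g s a (z a)))"
    by (rule iterated_circle_integral_cong) (rule F_eq)
  also have "\<dots> = (\<Sum>s\<in>?P \<times> ?P. c s *
      (\<Prod>a=1..n. contour_integral (circlepath 0 1) (\<lambda>w. 1 / w * g s a w)))"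
    by (rule iterated_circle_integral_sum_prod) (auto simp: finite_permutations g_cont)
  also have "\<dots> = (\<Sum>(p, q)\<in>?P \<times> ?P. signof p * signof q * (\<Prod>i<n.
      contour_integral (circlepath 0 1) (\<lambda>z. 1 / z * z powi (int (p i) - int (q i)) * f z)))"
  proof -
    have shift: "(\<Prod>a=1..n. h (a - 1)) = (\<Prod>i<n. h i)" for h :: "nat \<Rightarrow> complex"
      by (rule prod.reindex_bij_witness[of _ Suc "\<lambda>a. a - 1"]) auto
    show ?thesis
      using shift by (intro sum.cong refl) (simp add: c_def g_def mult.assoc case_prod_unfold)
  qed
  also have "\<dots> = fact n * Determinant.det (Matrix.mat n n (\<lambda>(a, b).
      contour_integral (circlepath 0 1) (\<lambda>z. 1 / z * z powi (int a - int b) * f z)))"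
    using det_sum_permuted_rows_and_columns[where n = n and m = "\<lambda>a b.
      contour_integral (circlepath 0 1) (\<lambda>z. 1 / z * z powi (int a - int b) * f z)"]
    by (simp only: of_nat_fact)
  finally show ?thesis .
qed

section \<open>The Toeplitz matrix and the symbol\<close>

text \<open>The Fourier coefficient with index \<open>j - k\<close> integrates against the power
  \<open>k - j\<close>, so the two matrices are transposes of each other.\<close>

lemma toeplitz_det_eq:
  "toeplitz_det n f = Determinant.det (Matrix.mat n n (\<lambda>(a, b).
     1 / (2 * of_real pi * \<i>) *
     contour_integral (circlepath 0 1) (\<lambda>z. 1 / z * z powi (int a - int b) * f z)))"
    (is "_ = Determinant.det ?A")
proof -
  have "Determinant.det (transpose_mat ?A) = Determinant.det ?A"
    by (rule det_transpose[of _ n]) simp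
  also have "transpose_mat ?A = Matrix.mat n n (\<lambda>(j, k). fourier_coeff f (int j - int k))"
    by (rule eq_matI) (simp_all add: fourier_coeff_def)
  finally show ?thesis by (simp add: toeplitz_det_def)
qed

lemma cmod_fund_weight:
  assumes "SU_fugacities Nf x" "k \<in> {1..Nf}"
  shows "cmod (fund_weight Nf x k) = 1"
proof -
  have unit: "cmod (x i) = 1" if "1 \<le> i" "i < Nf" for i
    using assms(1) that by (auto simp: SU_fugacities_def)
  consider "Nf = 1" | "Nf > 1" "k = 1" | "Nf > 1" "k = Nf" | "1 < k" "k < Nf"
    using assms(2) by force
  then show ?thesis
    by cases (simp_all add: fund_weight_def norm_divide unit)
qed

text \<open>The weights have modulus 1, so on the unit circle the terms subtracted from 1 have
  modulus \<open>t\<close> or \<open>t'\<close>, both below 1, and no denominator vanishes.\<close>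

lemma continuous_on_symbol_phi:
  assumes "0 \<le> t" "t < 1" "0 \<le> t'" "t' < 1" "SU_fugacities Nf x" "SU_fugacities Nf y"
  shows "continuous_on (sphere 0 1) (symbol_phi Nf t t' x y)"
proof -
  have "1 - w \<noteq> 0" if "cmod w < 1" for w :: complex
    using that by auto
  then show ?thesis
    unfolding symbol_phi_def using assms
    by (intro continuous_intros)
       (force simp: norm_mult norm_inverse cmod_fund_weight)+
qed

theorem mainTheorem1:
  fixes Nc Nf :: nat and t t' :: real and x y :: "nat \<Rightarrow> complex"
  assumes "Nc \<ge> 1" and "Nf \<ge> 1"
    and "0 \<le> t" and "t < 1" and "0 \<le> t'" and "t' < 1"
    and "SU_fugacities Nf x" and "SU_fugacities Nf y"
  shows "hilbert_series Nf Nc t t' x y =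
           Determinant.det (Matrix.mat Nc Nc (\<lambda>(a, b).
             1 / (2 * of_real pi * \<i>) *
             contour_integral (circlepath 0 1)
               (\<lambda>z. 1 / z * z powi (int a - int b) * symbol_phi Nf t t' x y z)))
         \<and> Determinant.det (Matrix.mat Nc Nc (\<lambda>(a, b).
             1 / (2 * of_real pi * \<i>) *
             contour_integral (circlepath 0 1)
               (\<lambda>z. 1 / z * z powi (int a - int b) * symbol_phi Nf t t' x y z)))
           = toeplitz_det Nc (symbol_phi Nf t t' x y)"
proof
  let ?c = "1 / (2 * of_real pi * \<i>)" and ?f = "symbol_phi Nf t t' x y"
  let ?m = "\<lambda>a b. contour_integral (circlepath 0 1)
    (\<lambda>z. 1 / z * z powi (int a - int b) * ?f z)"
  have "hilbert_series Nf Nc t t' x y =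
      ?c ^ Nc * Determinant.det (Matrix.mat Nc Nc (\<lambda>(a, b). ?m a b))"
    using Heine_identity[OF continuous_on_symbol_phi, OF assms(3-8), of Nc]
    by (simp add: hilbert_series_def power_one_over)
  \<comment> \<open>Each of the \<open>Nc\<close> rows absorbs one factor \<open>?c\<close>.\<close>
  also have "\<dots> = Determinant.det (Matrix.mat Nc Nc (\<lambda>(a, b). ?c * ?m a b))"
    using det_mult_rows[of Nc "\<lambda>_. ?c" ?m] by simp
  finally show "hilbert_series Nf Nc t t' x y =
      Determinant.det (Matrix.mat Nc Nc (\<lambda>(a, b). ?c * ?m a b))" .
  show "Determinant.det (Matrix.mat Nc Nc (\<lambda>(a, b). ?c * ?m a b)) = toeplitz_det Nc ?f"
    by (rule toeplitz_det_eq[symmetric])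
qed

end
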